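(* For any graph $G$, $\overline{\Theta}_G^*$ has either $1$ or $3$ equivalence classes.
   Context: Graphs are simple and undirected, with non-empty vertex set, not necessarily connected; $d$ is the shortest-path distance in $G$, with $d(u,v)=\infty$ if there is no path between $u$ and $v$ (and $\infty+\infty=\infty$). For edges $e=\{a,b\}$ and $f=\{x,y\}$ of $G$ the relation $\Theta_G$ on $E(G)$ is defined by $(e,f)\in\Theta_G$ iff $d(a,x)+d(b,y)\neq d(a,y)+d(b,x)$. The relation $\overline{\Theta}_G$ on $E(G)$ is defined by $(e,f)\in\overline{\Theta}_G$ iff $e=f$, or $e\neq f$ and $(e,f)\notin\Theta_G$. For a reflexive and symmetric binary relation $R$, $R^*$ denotes its transitive closure, i.e., the smallest transitive relation containing $R$; it is an equivalence relation.
   Formalization: The graph is assumed to have at least one edge; for an edgeless graph such as a single vertex the relation lives on the empty set and has 0 equivalence classes, so the claim as worded fails there. *)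

theory Defs
  imports Main "HOL-Library.Extended_Nat"
begin

definition simple_graph :: "'a set \<Rightarrow> 'a set set \<Rightarrow> bool" where
  "simple_graph V E \<longleftrightarrow> V \<noteq> {} \<and> (\<forall>e\<in>E. e \<subseteq> V \<and> card e = 2)"

definition is_path :: "'a set \<Rightarrow> 'a set set \<Rightarrow> 'a \<Rightarrow> 'a list \<Rightarrow> 'a \<Rightarrow> bool" where
  "is_path V E u p v \<longleftrightarrow> p \<noteq> [] \<and> hd p = u \<and> last p = v \<and> set p \<subseteq> V \<and> distinct p
     \<and> successively (\<lambda>x y. {x, y} \<in> E) p"

text \<open>The infimum of the empty set in \<^typ>\<open>enat\<close> is \<open>\<infinity>\<close>, so vertices that are not joined by a
  path are at distance \<open>\<infinity>\<close>.\<close>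

definition gdist :: "'a set \<Rightarrow> 'a set set \<Rightarrow> 'a \<Rightarrow> 'a \<Rightarrow> enat" where
  "gdist V E u v = (INF p \<in> {p. is_path V E u p v}. enat (length p - 1))"

text \<open>The existential quantifier over the names of the end vertices is harmless: exchanging the
  names of the two ends of an edge only swaps the two sides of the disequality, see
  \<open>Theta_iff\<close> below.\<close>

definition Theta :: "'a set \<Rightarrow> 'a set set \<Rightarrow> ('a set \<times> 'a set) set" where
  "Theta V E = {(e, f). e \<in> E \<and> f \<in> E \<and> (\<exists>a b x y. e = {a, b} \<and> f = {x, y} \<and>
     gdist V E a x + gdist V E b y \<noteq> gdist V E a y + gdist V E b x)}"

definition Theta_bar :: "'a set \<Rightarrow> 'a set set \<Rightarrow> ('a set \<times> 'a set) set" where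
  "Theta_bar V E = {(e, f). e \<in> E \<and> f \<in> E \<and> (e = f \<or> e \<noteq> f \<and> (e, f) \<notin> Theta V E)}"

text \<open>The transitive closure is \<open>trancl\<close>; the operator \<open>rtrancl\<close> would
  also relate every set that is not an edge to itself.\<close>

abbreviation Theta_bar_star :: "'a set \<Rightarrow> 'a set set \<Rightarrow> ('a set \<times> 'a set) set" where
  "Theta_bar_star V E \<equiv> (Theta_bar V E)\<^sup>+"

lemma Theta_iff:
  assumes "{a, b} \<in> E" "{x, y} \<in> E"
  shows "({a, b}, {x, y}) \<in> Theta V E \<longleftrightarrow>
    gdist V E a x + gdist V E b y \<noteq> gdist V E a y + gdist V E b x"
  using assms unfolding Theta_def by (auto simp: doubleton_eq_iff add.commute)

lemma is_path_rev: "is_path V E u p v \<Longrightarrow> is_path V E v (rev p) u"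
  unfolding is_path_def by (auto simp: hd_rev last_rev insert_commute)

lemma gdist_commute: "gdist V E u v = gdist V E v u"
proof -
  have "gdist V E v u \<le> gdist V E u v" for u v
    unfolding gdist_def
    by (rule INF_mono) (use is_path_rev length_rev in \<open>metis mem_Collect_eq order_refl\<close>)
  then show ?thesis by (simp add: order_antisym)
qed

lemma Theta_sym: "(e, f) \<in> Theta V E \<Longrightarrow> (f, e) \<in> Theta V E"
proof -
  assume "(e, f) \<in> Theta V E"
  then obtain a b x y where "e \<in> E" "f \<in> E" "e = {a, b}" "f = {x, y}"
    and "gdist V E a x + gdist V E b y \<noteq> gdist V E a y + gdist V E b x"
    unfolding Theta_def by blast
  then show ?thesis
    using Theta_iff[of x y E a b V]
    by (simp add: gdist_commute[of V E x] gdist_commute[of V E y] add.commute)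
qed

lemma equiv_Theta_bar_star: "equiv E (Theta_bar_star V E)"
proof (rule equivI)
  have sub: "Theta_bar V E \<subseteq> E \<times> E" by (auto simp: Theta_bar_def)
  show "Theta_bar_star V E \<subseteq> E \<times> E" using trancl_subset_Sigma[OF sub] .
  show "refl_on E (Theta_bar_star V E)"
    by (auto simp: refl_on_def Theta_bar_def)
  have "sym (Theta_bar V E)"
    by (auto simp: sym_def Theta_bar_def dest: Theta_sym)
  then show "sym (Theta_bar_star V E)" by (rule sym_trancl)
  show "trans (Theta_bar_star V E)" by (rule trans_trancl)
qed

end

theory Submission imports Defs begin

text \<open>If some triangle has all its edges in one class \<open>C\<close>, then \<open>C = E\<close>: the property
  ``all edges at \<open>v\<close> and at every neighbour of \<open>v\<close> lie in \<open>C\<close>'' holds for the vertices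
  of the triangle and passes from \<open>v\<close> to its neighbours, and edges in different components are
  related because all their distances are infinite. Induced paws, copies of \<open>K\<^sub>5\<close>, and
  triangles in a graph with edges in several components all yield such a triangle. If there is no
  triangle at all, adjacent edges are related and again there is one class. In the remaining case
  the graph is, up to isolated vertices, complete multipartite with three or four parts; the classes
  then correspond to the three ways of splitting a set of four parts into two pairs.\<close>

locale simple_graph_loc =
  fixes V :: "'a set" and E :: "'a set set"
  assumes simple: "simple_graph V E"
begin

section \<open>Adjacency, reachability and small distances\<close>

definition adj :: "'a \<Rightarrow> 'a \<Rightarrow> bool" where
  "adj x y \<longleftrightarrow> {x, y} \<in> E"

abbreviation rel :: "'a set \<Rightarrow> 'a set \<Rightarrow> bool" (infix "\<sim>" 50) where
  "e \<sim> f \<equiv> (e, f) \<in> Theta_bar_star V E"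

lemma adj_sym: "adj x y \<Longrightarrow> adj y x"
  by (simp add: adj_def insert_commute)

lemma adj_irrefl [simp]: "\<not> adj x x"
  using simple by (auto simp: adj_def simple_graph_def)

lemma adj_in_V: "adj x y \<Longrightarrow> x \<in> V"
  using simple by (auto simp: adj_def simple_graph_def)

lemma edgeE:
  assumes "e \<in> E"
  obtains x y where "e = {x, y}" "adj x y"
  using assms simple unfolding adj_def simple_graph_def by (metis card_2_iff)

lemma rel_refl: "e \<in> E \<Longrightarrow> e \<sim> e"
  using equiv_Theta_bar_star by (rule equiv_class_self[simplified Image_singleton_iff])

lemma rel_sym: "e \<sim> f \<Longrightarrow> f \<sim> e"
  using equiv_Theta_bar_star[of E V] by (meson equiv_def symD)

lemma rel_trans: "e \<sim> f \<Longrightarrow> f \<sim> g \<Longrightarrow> e \<sim> g"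
  by (rule trancl_trans)

lemma is_path_reachable: "is_path V E u p v \<Longrightarrow> adj\<^sup>*\<^sup>* u v"
proof (induction p arbitrary: u)
  case (Cons w p)
  show ?case
  proof (cases p)
    case (Cons z q)
    then have "adj u z" "is_path V E z p v"
      using Cons.prems by (auto simp: is_path_def adj_def)
    then show ?thesis
      using Cons.IH by (meson converse_rtranclp_into_rtranclp)
  qed (use Cons.prems in \<open>auto simp: is_path_def\<close>)
qed (simp add: is_path_def)

lemma gdist_unreachable: "\<not> adj\<^sup>*\<^sup>* u v \<Longrightarrow> gdist V E u v = \<infinity>"
proof -
  assume "\<not> adj\<^sup>*\<^sup>* u v"
  then have "{p. is_path V E u p v} = {}" using is_path_reachable by blast
  then show ?thesis by (simp add: gdist_def top_enat_def)
qed

lemma gdist_le: "is_path V E u p v \<Longrightarrow> gdist V E u v \<le> enat (length p - 1)"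
  unfolding gdist_def by (rule INF_lower) simp

lemma gdist_self: "x \<in> V \<Longrightarrow> gdist V E x x = 0"
  using gdist_le[of x "[x]" x] by (simp add: is_path_def flip: zero_enat_def)

lemma gdist_adj:
  assumes "adj x y"
  shows "gdist V E x y = 1"
proof (rule antisym)
  have "x \<noteq> y" using assms by auto
  then show "gdist V E x y \<le> 1"
    using gdist_le[of x "[x, y]" y] assms adj_in_V[of x y] adj_in_V[of y x] adj_sym[of x y]
    by (simp add: is_path_def adj_def one_enat_def)
  show "1 \<le> gdist V E x y"
    unfolding gdist_def
  proof (rule INF_greatest)
    fix p assume "p \<in> {p. is_path V E x p y}"
    with \<open>x \<noteq> y\<close> show "1 \<le> enat (length p - 1)"
      by (cases p; cases "tl p") (auto simp: is_path_def one_enat_def)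
  qed
qed

lemma gdist_common_neighbour:
  assumes "adj x w" "adj w y" "\<not> adj x y" "x \<noteq> y"
  shows "gdist V E x y = 2"
proof (rule antisym)
  have "x \<noteq> w" "w \<noteq> y" using assms by auto
  then have "is_path V E x [x, w, y] y"
    using assms adj_in_V adj_sym[of w y] by (auto simp: is_path_def adj_def)
  then show "gdist V E x y \<le> 2"
    using gdist_le[of x "[x, w, y]" y] by (simp add: numeral_2_eq_2 numeral_eq_enat)
  show "2 \<le> gdist V E x y"
    unfolding gdist_def
  proof (rule INF_greatest)
    fix p assume "p \<in> {p. is_path V E x p y}"
    with assms(3,4) show "2 \<le> enat (length p - 1)"
      by (cases p; cases "tl p"; cases "tl (tl p)")
        (auto simp: is_path_def adj_def numeral_eq_enat)
  qed
qed

section \<open>Edges related because of their distances\<close>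

lemma relI:
  assumes "adj a b" "adj x y"
    and "gdist V E a x + gdist V E b y = gdist V E a y + gdist V E b x"
  shows "{a, b} \<sim> {x, y}"
  using assms Theta_iff[of a b E x y V]
  by (intro r_into_trancl) (auto simp: Theta_bar_def adj_def)

text \<open>If \<open>x\<close> and \<open>z\<close> differ, one sum is 1 + 1 and the other is 2 +
  0, the 0 coming from the shared vertex \<open>y\<close>. If \<open>x = z\<close>, the two edges
  coincide.\<close>

lemma rel_fork:
  assumes "adj x y" "adj y z" "\<not> adj x z"
  shows "{x, y} \<sim> {y, z}"
proof (cases "x = z")
  case True
  then show ?thesis
    using rel_refl assms(1) by (simp add: adj_def insert_commute)
next
  case False
  then show ?thesis
    using assms adj_in_V
    by (intro relI) (auto simp: gdist_adj gdist_self gdist_common_neighbour[of x y z] one_add_one)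
qed

text \<open>Neither end of \<open>{w, v}\<close> tells \<open>y\<close> from \<open>z\<close>: both
  are at distance 1 from \<open>w\<close>, and their distances to \<open>v\<close> are both 1 or,
  via \<open>w\<close>, both 2. This serves opposite edges of a \<open>K4\<close> as well as the
  pendant edge of a paw and the triangle edge it does not meet.\<close>

lemma rel_twins:
  assumes "adj y z" "adj w v" "adj y w" "adj z w" "adj y v \<longleftrightarrow> adj z v" "y \<noteq> v" "z \<noteq> v"
  shows "{y, z} \<sim> {w, v}"
proof (rule relI)
  have "gdist V E y v = gdist V E z v"
    using assms gdist_common_neighbour[of y w v] gdist_common_neighbour[of z w v]
    by (cases "adj y v") (auto simp: gdist_adj)
  then show "gdist V E y w + gdist V E z v = gdist V E y v + gdist V E z w"
    using assms by (simp add: gdist_adj add.commute)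
qed (use assms in auto)

lemma rel_unreachable:
  assumes "adj a b" "adj x y" "\<not> adj\<^sup>*\<^sup>* a x"
  shows "{a, b} \<sim> {x, y}"
proof (rule relI)
  have "\<not> adj\<^sup>*\<^sup>* b x" "\<not> adj\<^sup>*\<^sup>* a y"
    using assms adj_sym[of x y]
    by (meson converse_rtranclp_into_rtranclp rtranclp.rtrancl_into_rtrancl)+
  then show "gdist V E a x + gdist V E b y = gdist V E a y + gdist V E b x"
    using assms by (simp add: gdist_unreachable)
qed (use assms in auto)

lemma rel_all_if_reachable:
  assumes "adj a b" "\<And>x y. adj\<^sup>*\<^sup>* a x \<Longrightarrow> adj x y \<Longrightarrow> {a, b} \<sim> {x, y}" "e \<in> E"
  shows "{a, b} \<sim> e"
  using assms rel_unreachable by (metis edgeE)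

section \<open>Triangles inside one class, and triangle-free graphs\<close>

definition mono_triangle :: "'a \<Rightarrow> 'a \<Rightarrow> 'a \<Rightarrow> bool" where
  "mono_triangle a b c \<longleftrightarrow> adj a b \<and> adj b c \<and> adj a c \<and> {a, b} \<sim> {b, c} \<and> {a, b} \<sim> {a, c}"

lemma mono_triangle_rel_all:
  assumes "mono_triangle a b c" "e \<in> E"
  shows "{a, b} \<sim> e"
proof -
  define G where "G x y \<longleftrightarrow> {a, b} \<sim> {x, y}" for x y
  define good where "good v \<longleftrightarrow> (\<forall>w. adj v w \<longrightarrow> G v w)" for v
  define T where "T = {a, b, c}"
  have ab: "adj a b" "adj b c" "adj a c" "adj b a" "adj c b" "adj c a"
    using assms adj_sym by (auto simp: mono_triangle_def)
  have Gsym: "G x y \<Longrightarrow> G y x" for x y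
    by (simp add: G_def insert_commute)
  have Gfork: "G y z" if "G x y" "adj x y" "adj y z" "\<not> adj x z" for x y z
    using that rel_fork rel_trans unfolding G_def by blast
  have Gtwins: "G y z" if "G w v" "adj y z" "adj w v" "adj y w" "adj z w"
      "adj y v \<longleftrightarrow> adj z v" "y \<noteq> v" "z \<noteq> v" for y z w v
    using that rel_twins[of y z w v] rel_trans rel_sym unfolding G_def by blast
  have GT: "G x y" "adj x y" if "x \<in> T" "y \<in> T" "x \<noteq> y" for x y
    using that assms Gsym rel_refl[of "{a, b}"] ab
    by (auto simp: T_def mono_triangle_def G_def adj_def insert_commute)
  have goodE: "G x y" if "good x" "adj x y" for x y
    using that by (simp add: good_def)
  have T_good: "good u" if uT: "u \<in> T" for u
    unfolding good_def
  proof (intro allI impI)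
    fix d assume ud: "adj u d"
    obtain v w where vw: "v \<in> T" "w \<in> T" "u \<noteq> v" "u \<noteq> w" "v \<noteq> w"
      using uT ab unfolding T_def by (metis adj_irrefl insertCI insertE singletonD)
    show "G u d"
    proof (cases "d \<in> T")
      case True
      then show ?thesis using GT ud uT by fastforce
    next
      case False
      \<comment> \<open>If \<open>d\<close> sees \<open>v\<close> and \<open>w\<close>, there is a
        \<open>K4\<close> in which \<open>{u, d}\<close> is opposite to \<open>{v, w}\<close>.
        Otherwise a missing edge at \<open>d\<close> gives a fork centred at
        \<open>u\<close>.\<close>
      show ?thesis
      proof (cases "adj v d \<and> adj w d")
        case True
        then show ?thesis
          using Gtwins[of v w u d] GT[OF vw(1,2)] GT[OF uT vw(1)] GT[OF uT vw(2)] vw ud False adj_sym uT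
          by metis
      next
        case False
        then show ?thesis
          using Gfork[of v u d] Gfork[of w u d] GT[OF vw(1) uT] GT[OF vw(2) uT] vw ud by metis
      qed
    qed
  qed
  have nb_good: "good y" if ya: "adj a y" for y
    unfolding good_def
  proof (intro allI impI)
    fix z assume yz: "adj y z"
    show "G y z"
    proof (cases "y \<in> T \<or> z \<in> T")
      case True
      then show ?thesis
        using T_good goodE Gsym yz adj_sym by blast
    next
      case False
      \<comment> \<open>Now \<open>{y, z}\<close> avoids the triangle. If its ends have the same
        neighbours in \<open>T\<close>, they are twins for \<open>{a, b}\<close>. Otherwise some
        \<open>t\<close> sees exactly one end, and its good edge to that end forks into
        \<open>{y, z}\<close>.\<close>
      show ?thesis
      proof (cases "\<forall>t\<in>T. adj y t \<longleftrightarrow> adj z t")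
        case True
        then have "adj y a" "adj z a" "adj y b \<longleftrightarrow> adj z b" "a \<noteq> b"
          using ya ab adj_sym by (auto simp: T_def)
        then show ?thesis
          using Gtwins[of a b y z] GT[of a b] False ab yz by (auto simp: T_def)
      next
        case False
        then obtain t where "t \<in> T" "adj y t \<noteq> adj z t" by blast
        then show ?thesis
          using Gfork[of t z y] Gfork[of t y z] T_good goodE Gsym yz adj_sym by metis
      qed
    qed
  qed
  have propagate: "good y" if v: "\<And>u. adj v u \<Longrightarrow> good u" and vw: "adj v w" and wy: "adj w y" for v w y
  proof (cases "adj v y")
    case False
    have w: "good w" using v vw by blast
    show ?thesis
      unfolding good_def
    proof (intro allI impI)
      fix z assume yz: "adj y z"
      \<comment> \<open>Either \<open>z\<close> is a good neighbour of \<open>v\<close>, or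
        \<open>w\<close>, \<open>y\<close>, \<open>z\<close> form a fork, or \<open>y\<close> and
        \<open>z\<close> both see \<open>w\<close> and both miss \<open>v\<close>, making them twins
        for \<open>{w, v}\<close>.\<close>
      consider "adj v z" | "\<not> adj w z" | "adj w z" "\<not> adj v z" by blast
      then show "G y z"
      proof cases
        case 1
        then show ?thesis using v goodE Gsym yz adj_sym by blast
      next
        case 2
        then show ?thesis using Gfork[of w y z] goodE[OF w] wy yz by blast
      next
        case 3
        then show ?thesis
          using Gtwins[of w v y z] goodE[OF w] False vw wy yz adj_sym by metis
      qed
    qed
  qed (use v in blast)
  \<comment> \<open>The neighbours belong to the invariant because \<open>propagate\<close> needs
    all of them to be good.\<close>
  have "good x \<and> (\<forall>y. adj x y \<longrightarrow> good y)" if "adj\<^sup>*\<^sup>* a x" for x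
    using that
  proof induction
    case base
    then show ?case using T_good nb_good by (simp add: T_def)
  next
    case (step y z)
    then show ?case using propagate by blast
  qed
  then show ?thesis
    using rel_all_if_reachable[of a b e] assms(2) ab goodE unfolding G_def by blast
qed

text \<open>Any two edges with a common end form a fork here, so the class spreads along
  paths.\<close>

lemma triangle_free_rel_all:
  assumes free: "\<And>x y z. adj x y \<Longrightarrow> adj y z \<Longrightarrow> \<not> adj x z" and "adj a b" "e \<in> E"
  shows "{a, b} \<sim> e"
proof -
  have "\<forall>y. adj x y \<longrightarrow> {a, b} \<sim> {x, y}" if "adj\<^sup>*\<^sup>* a x" for x
    using that
  proof induction
    case base
    then show ?case
      using rel_fork[of b a] free \<open>adj a b\<close> adj_sym by (metis insert_commute)
  next
    case (step y z)
    then show ?case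
      using rel_fork[of y z] free rel_trans by metis
  qed
  then show ?thesis
    using rel_all_if_reachable assms(2,3) by blast
qed

text \<open>The pendant edge \<open>{u, d}\<close> is related to all three triangle edges: by forks
  at \<open>u\<close> to two of them, and by twins to \<open>{v, w}\<close>.\<close>

lemma mono_triangle_if_paw:
  assumes "adj u v" "adj v w" "adj u w" "adj u d" "\<not> adj v d" "\<not> adj w d"
  shows "mono_triangle u v w"
proof -
  have "{v, u} \<sim> {u, d}" "{w, u} \<sim> {u, d}"
    using assms adj_sym by (auto intro!: rel_fork)
  moreover have "{v, w} \<sim> {u, d}"
    using assms adj_sym by (intro rel_twins) auto
  ultimately have "{u, v} \<sim> {u, d}" "{u, w} \<sim> {u, d}" "{v, w} \<sim> {u, d}"
    by (simp_all add: insert_commute)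
  then show ?thesis
    using assms(1-3) unfolding mono_triangle_def by (blast intro: rel_sym rel_trans)
qed

text \<open>Disjoint edges of a \<open>K5\<close> are opposite in some \<open>K4\<close>.
  Disjointness makes the ten edges a Petersen graph, which is connected; the relations listed form
  two walks in it from \<open>{a, b}\<close>.\<close>

lemma mono_triangle_if_K5:
  assumes "adj a b" "adj b c" "adj a c" "adj d a" "adj d b" "adj d c"
    and "adj d' a" "adj d' b" "adj d' c" "adj d d'"
  shows "mono_triangle a b c"
proof -
  have K4: "{x, y} \<sim> {z, w}"
    if "adj x y" "adj z w" "adj x z" "adj y z" "adj x w" "adj y w" for x y z w
    using that by (intro rel_twins) auto
  note s = assms assms[THEN adj_sym]
  have "{a, b} \<sim> {c, d}" "{c, d} \<sim> {a, d'}" "{a, d'} \<sim> {b, c}" "{c, d} \<sim> {b, d'}" "{b, d'} \<sim> {a, c}"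
    by (auto intro!: K4 s)
  then show ?thesis
    using assms rel_trans unfolding mono_triangle_def by blast
qed

section \<open>Counting classes, and the complete multipartite case\<close>

lemma card_quotient_eq_1:
  assumes "e0 \<in> E" "\<And>e. e \<in> E \<Longrightarrow> e0 \<sim> e"
  shows "card (E // Theta_bar_star V E) = 1"
proof -
  have "E // Theta_bar_star V E = {Theta_bar_star V E `` {e0}}"
    using assms equiv_class_eq[OF equiv_Theta_bar_star[of E V]] by (auto simp: quotient_def)
  then show ?thesis by simp
qed

lemma card_quotient_eq_3:
  assumes "e1 \<in> E" "e2 \<in> E" "e3 \<in> E" "\<not> e1 \<sim> e2" "\<not> e1 \<sim> e3" "\<not> e2 \<sim> e3"
    and "\<And>e. e \<in> E \<Longrightarrow> e1 \<sim> e \<or> e2 \<sim> e \<or> e3 \<sim> e"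
  shows "card (E // Theta_bar_star V E) = 3"
proof -
  let ?c = "\<lambda>e. Theta_bar_star V E `` {e}"
  note eq = eq_equiv_class_iff[OF equiv_Theta_bar_star[of E V]]
  have "?c e \<in> ?c ` {e1, e2, e3}" if "e \<in> E" for e
    using assms(7)[OF that] equiv_class_eq[OF equiv_Theta_bar_star[of E V]] by blast
  then have "E // Theta_bar_star V E = ?c ` {e1, e2, e3}"
    using assms(1-3) by (auto simp: quotient_def)
  moreover have "inj_on ?c {e1, e2, e3}"
    using assms eq rel_sym by (auto simp: inj_on_def)
  moreover have "card {e1, e2, e3} = 3"
    using assms rel_refl by (auto simp: card_insert_if)
  ultimately show ?thesis
    using card_image by metis
qed

text \<open>The colour \<open>p x\<close> names the part of \<open>x\<close>, and the edge type \<open>t e\<close> is the exclusive or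
  of the colours of its ends, so complementary pairs of parts get the same type.\<close>

lemma multipartite_type_invariant:
  fixes p :: "'a \<Rightarrow> bool \<times> bool"
  assumes adj_iff: "\<And>x y x' y'. adj x x' \<Longrightarrow> adj y y' \<Longrightarrow> adj x y \<longleftrightarrow> p x \<noteq> p y"
    and t: "\<And>x y. t {x, y} = (fst (p x) \<noteq> fst (p y), snd (p x) \<noteq> snd (p y))"
    and "e \<sim> f"
  shows "t e = t f"
proof -
  \<comment> \<open>For edges with exactly one common part, the distance within that part is 0 or 2
    and the other three are 1, so 1 or 3 is compared with 2.\<close>
  have Theta: "({x, y}, {z, w}) \<in> Theta V E"
    if "adj x y" "adj z w" "p x = p z" "p y \<noteq> p w" for x y z w
  proof -
    have nadj: "\<not> adj x z" using that adj_iff by blast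
    have a: "adj y w" "adj x w" "adj y z"
      using that adj_iff adj_sym by (metis adj_irrefl)+
    have "gdist V E x z \<in> {0, 2}"
      using gdist_common_neighbour[of x y z] gdist_self[of x] nadj a that adj_in_V
      by auto
    moreover have "0 + 1 \<noteq> (1 + 1 :: enat)" "2 + 1 \<noteq> (1 + 1 :: enat)"
      by (simp_all add: one_enat_def numeral_eq_enat)
    ultimately show ?thesis
      using a that by (auto simp: Theta_iff adj_def[symmetric] gdist_adj)
  qed
  have step: "t e = t f" if ef: "(e, f) \<in> Theta_bar V E" for e f
  proof (rule ccontr)
    assume ne: "t e \<noteq> t f"
    have "e \<in> E" "f \<in> E" "(e, f) \<notin> Theta V E"
      using ef ne by (auto simp: Theta_bar_def)
    then obtain x y z w where e: "e = {x, y}" "adj x y" and f: "f = {z, w}" "adj z w"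
      by (metis edgeE)
    have "p x \<noteq> p y" "p z \<noteq> p w"
      using e f adj_iff adj_sym by blast+
    \<comment> \<open>Equal or complementary pairs among the four colours have the same type, so
      different types force exactly one common colour.\<close>
    then have "p x = p z \<and> p y \<noteq> p w \<or> p x = p w \<and> p y \<noteq> p z
        \<or> p y = p z \<and> p x \<noteq> p w \<or> p y = p w \<and> p x \<noteq> p z"
      using ne unfolding e f t by (cases "p x"; cases "p y"; cases "p z"; cases "p w") auto
    then have "(e, f) \<in> Theta V E"
      using Theta[of x y z w] Theta[of x y w z] Theta[of y x z w] Theta[of y x w z] e f adj_sym
      by (metis insert_commute)
    then show False using \<open>(e, f) \<notin> Theta V E\<close> by blast
  qed
  show ?thesis
    using \<open>e \<sim> f\<close> by (induction rule: trancl.induct) (use step in auto)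
qed

lemma card_quotient_no_mono_triangle:
  assumes nomono: "\<And>x y z. \<not> mono_triangle x y z" and tri: "adj a b" "adj b c" "adj a c"
  shows "card (E // Theta_bar_star V E) = 3"
proof -
  note s = tri tri[THEN adj_sym]
  have nopaw: "adj v d \<or> adj w d" if "adj u v" "adj v w" "adj u w" "adj u d" for u v w d
    using that nomono mono_triangle_if_paw by blast
  define two where "two x \<longleftrightarrow> (adj a x \<and> adj b x) \<or> (adj b x \<and> adj c x) \<or> (adj a x \<and> adj c x)" for x
  have reach: "adj\<^sup>*\<^sup>* a x" if "adj x y" for x y
  proof (rule ccontr)
    assume nr: "\<not> adj\<^sup>*\<^sup>* a x"
    then have "\<not> adj\<^sup>*\<^sup>* b x" using tri(1) by (meson converse_rtranclp_into_rtranclp)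
    then have "{a, b} \<sim> {x, y}" "{a, c} \<sim> {x, y}" "{b, c} \<sim> {x, y}"
      using nr s that rel_unreachable by blast+
    then have "mono_triangle a b c"
      using s rel_sym rel_trans unfolding mono_triangle_def by blast
    then show False using nomono by blast
  qed
  have two_reach: "two x" if "adj\<^sup>*\<^sup>* a x" for x
    using that
  proof induction
    case base
    then show ?case using s by (simp add: two_def)
  next
    case (step y z)
    \<comment> \<open>The vertex \<open>y\<close> lies in a triangle with two of \<open>a\<close>,
      \<open>b\<close>, \<open>c\<close>. Absence of paws there gives \<open>z\<close> one neighbour
      among them, and in the triangle \<open>a\<close>, \<open>b\<close>, \<open>c\<close> itself a
      second one.\<close>
    have "adj a z \<or> adj b z \<or> adj c z"
      using nopaw[of y a b z] nopaw[of y b c z] nopaw[of y a c z] s step adj_sym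
      unfolding two_def by blast
    then show ?case
      using nopaw[of a b c z] nopaw[of b a c z] nopaw[of c a b z] s
      unfolding two_def by blast
  qed
  have two: "two x" if "adj x y" for x y
    using that reach two_reach by blast
  \<comment> \<open>On non-isolated vertices the colour records the triangle vertex that is missed:
    \<open>(True, False)\<close> for \<open>a\<close>, \<open>(False, True)\<close> for
    \<open>b\<close>, \<open>(True, True)\<close> for \<open>c\<close>, and
    \<open>(False, False)\<close> for none.\<close>
  define p where "p x = (\<not> adj a x \<or> \<not> adj c x, \<not> adj b x \<or> \<not> adj c x)" for x
  \<comment> \<open>The value is unique because exclusive or does not change when the ends are
    exchanged.\<close>
  define t where "t e = (THE r. \<forall>x y. e = {x, y} \<longrightarrow>
    r = (fst (p x) \<noteq> fst (p y), snd (p x) \<noteq> snd (p y)))" for e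
  have t: "t {x, y} = (fst (p x) \<noteq> fst (p y), snd (p x) \<noteq> snd (p y))" for x y
    unfolding t_def by (rule the_equality) (auto simp: doubleton_eq_iff)
  \<comment> \<open>A violation of any of the next three facts is a paw: no edges inside the part of
    \<open>u\<close>, and all edges from it to other parts. For \<open>full_indep\<close> a
    violation is a \<open>K5\<close>.\<close>
  have part_indep: "\<not> adj x y"
    if "adj u v" "adj v x" "adj v y" "\<not> adj u x" "\<not> adj u y" for u v x y
    using nopaw[of v x y u] that adj_sym by blast
  have parts_joined: "adj x y"
    if "adj u v" "adj v w" "adj u w" "adj v x" "adj w x" "\<not> adj u x" "adj u y" "adj w y" "\<not> adj v y"
    for u v w x y
    using nopaw[of w v x y] that adj_sym by blast
  have part_full_joined: "adj x y"
    if "adj u v" "adj v x" "\<not> adj u x" "adj u y" "adj v y" for u v x y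
    using nopaw[of v u y x] that adj_sym by blast
  have full_indep: "\<not> adj x y"
    if "adj a x" "adj b x" "adj c x" "adj a y" "adj b y" "adj c y" for x y
    using mono_triangle_if_K5[of a b c x y] nomono that tri adj_sym by blast
  \<comment> \<open>The neighbours \<open>x'\<close> and \<open>y'\<close> exclude isolated
    vertices, which receive the colour of \<open>c\<close>.\<close>
  have adj_iff: "adj x y \<longleftrightarrow> p x \<noteq> p y" if "adj x x'" "adj y y'" for x y x' y'
  proof
    assume xy: "adj x y"
    show "p x \<noteq> p y"
      using two[OF that(1)] two[OF that(2)] xy full_indep[of x y]
        part_indep[of a b x y] part_indep[of b c x y] part_indep[of c a x y] s
      unfolding p_def two_def by auto
  next
    assume ne: "p x \<noteq> p y"
    have cases: "(adj a z \<and> adj b z \<and> adj c z) \<or> (\<not> adj a z \<and> adj b z \<and> adj c z)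
        \<or> (adj a z \<and> \<not> adj b z \<and> adj c z) \<or> (adj a z \<and> adj b z \<and> \<not> adj c z)" if "two z" for z
      using that unfolding two_def by blast
    have half: "adj x y" if "two x" "two y" "\<not> adj u x" "adj u y" "u \<in> {a, b, c}" for x y u
    proof (cases "adj a y \<and> adj b y \<and> adj c y")
      case True
      then show ?thesis
        using that cases[OF \<open>two x\<close>] part_full_joined[of a b x y] part_full_joined[of b c x y]
          part_full_joined[of c a x y] s by blast
    next
      case False
      then show ?thesis
        using that cases[OF \<open>two x\<close>] cases[OF \<open>two y\<close>] s
          parts_joined[of a b c x y] parts_joined[of a c b x y] parts_joined[of b a c x y]
          parts_joined[of b c a x y] parts_joined[of c a b x y] parts_joined[of c b a x y] by blast
    qed
    have "\<exists>u\<in>{a, b, c}. adj u x \<noteq> adj u y"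
      using ne unfolding p_def by auto
    then show "adj x y"
      using half[of x y] half[of y x] two that adj_sym by blast
  qed
  have inv: "t e = t f" if "e \<sim> f" for e f
    by (rule multipartite_type_invariant[OF adj_iff t that])
  have p_abc: "p a = (True, False)" "p b = (False, True)" "p c = (True, True)"
    using s by (auto simp: p_def)
  show ?thesis
  proof (rule card_quotient_eq_3)
    show "{a, b} \<in> E" "{b, c} \<in> E" "{a, c} \<in> E"
      using tri by (auto simp: adj_def)
    show "\<not> {a, b} \<sim> {b, c}" "\<not> {a, b} \<sim> {a, c}" "\<not> {b, c} \<sim> {a, c}"
      using inv[of "{a, b}" "{b, c}"] inv[of "{a, b}" "{a, c}"] inv[of "{b, c}" "{a, c}"]
      by (auto simp: t p_abc)
    have same: "{u, v} \<sim> {x, y}"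
      if "adj u v" "adj x y" "p x = p u" "p y = p v" for u v x y
    proof -
      have "adj x v" "\<not> adj u x" "\<not> adj v y"
        using that adj_iff[of x y v u] adj_iff[of u v x y] adj_iff[of v u y x] adj_iff[of x y y x]
          adj_sym by auto
      \<comment> \<open>Two edges between the same two parts are linked through the cross edge
        \<open>{v, x}\<close> by two forks.\<close>
      then have "{u, v} \<sim> {v, x}" "{v, x} \<sim> {x, y}"
        using rel_fork[of u v x] rel_fork[of v x y] that adj_sym by blast+
      then show ?thesis by (rule rel_trans)
    qed
    \<comment> \<open>The four ends span a \<open>K4\<close> in which the two edges are
      opposite.\<close>
    have disj: "{u, v} \<sim> {x, y}"
      if "adj u v" "adj x y" "p u \<notin> {p x, p y}" "p v \<notin> {p x, p y}" for u v x y
    proof -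
      have "adj u x" "adj u y" "adj v x" "adj v y"
        using that adj_iff adj_sym by blast+
      then show ?thesis
        using that by (intro rel_twins) auto
    qed
    fix e assume "e \<in> E"
    then obtain x y where e: "e = {x, y}" and xy: "adj x y" by (rule edgeE)
    have "p x \<noteq> p y" using xy adj_iff adj_sym by blast
    have ends: "{u, v} \<sim> {x, y}"
      if "adj u v" "p x = p u \<and> p y = p v \<or> p x = p v \<and> p y = p u
        \<or> p u \<notin> {p x, p y} \<and> p v \<notin> {p x, p y}" for u v
      using that same[of u v x y] same[of u v y x] disj[of u v x y] xy adj_sym
      by (metis insert_commute)
    \<comment> \<open>Of the six pairs of colours, three are those of the triangle edges and the
      other three are their complements.\<close>
    show "{a, b} \<sim> e \<or> {b, c} \<sim> e \<or> {a, c} \<sim> e"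
      using ends[of a b] ends[of b c] ends[of a c] tri \<open>p x \<noteq> p y\<close>
      unfolding e p_abc by (cases "p x"; cases "p y") auto
  qed
qed

end

theorem corollary3p15:
  fixes V :: "'a set" and E :: "'a set set"
  assumes "simple_graph V E" and "E \<noteq> {}"
  shows "card (E // Theta_bar_star V E) = 1 \<or> card (E // Theta_bar_star V E) = 3"
proof -
  interpret simple_graph_loc V E by unfold_locales fact
  consider (mono) a b c where "mono_triangle a b c"
    | (free) "\<And>x y z. adj x y \<Longrightarrow> adj y z \<Longrightarrow> \<not> adj x z"
    | (tri) a b c where "\<And>x y z. \<not> mono_triangle x y z" "adj a b" "adj b c" "adj a c"
    by blast
  then show ?thesis
  proof cases
    case mono
    then have "{a, b} \<in> E"
      by (simp add: mono_triangle_def adj_def)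
    then show ?thesis
      using card_quotient_eq_1 mono_triangle_rel_all[OF mono] by blast
  next
    case free
    obtain e where "e \<in> E" using assms(2) by blast
    then obtain a b where "e = {a, b}" "adj a b" by (rule edgeE)
    then have "e \<sim> f" if "f \<in> E" for f
      using triangle_free_rel_all[of a b f] free that by simp
    then show ?thesis
      using card_quotient_eq_1[of e] \<open>e \<in> E\<close> by blast
  next
    case tri
    then show ?thesis using card_quotient_no_mono_triangle by blast
  qed
qed

end
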